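(* For every integer $n\geqslant 1$, $C_n(x)=\det H_n$, where $H_n=(h_{ij})_{1\leqslant i,j\leqslant n}$ is the $n\times n$ lower Hessenberg matrix with entries $$h_{ij}=\begin{cases}\binom{i}{j-1}C_{i-j}(x), & j<i,\\ \binom{i}{i-1}x=ix, & j=i,\\ -1, & j=i+1,\\ 0, & j>i+1.\end{cases}$$ That is, $$C_{n}(x)=\begin{vmatrix} x&-1&0&\cdots&0&0\\ C_1(x)&\binom{2}{1}x&-1&\cdots&0&0\\ C_2(x)&\binom{3}{1}C_1(x)&\binom{3}{2}x&\cdots&0&0\\ \vdots&\vdots&\vdots&\ddots&\vdots&\vdots\\ C_{n-2}(x)&\binom{n-1}{1}C_{n-3}(x)&\binom{n-1}{2}C_{n-4}(x)&\cdots&\binom{n-1}{n-2}x&-1\\ C_{n-1}(x)&\binom{n}{1}C_{n-2}(x)&\binom{n}{2}C_{n-3}(x)&\cdots&\binom{n}{n-2}C_1(x)&\binom{n}{n-1}x \end{vmatrix}.$$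
   Context: For $n\geqslant 1$, $\mathcal{Q}_n$ denotes the set of Stirling permutations of the multiset $\{1,1,2,2,\ldots,n,n\}$, i.e. words $\sigma=\sigma_1\cdots\sigma_{2n}$ using each of $1,\ldots,n$ exactly twice such that for each $i$ all letters between the two occurrences of $i$ are at least $i$. Set $\sigma_0=\sigma_{2n+1}=0$, and let ${\rm des}(\sigma)=\#\{i\in\{0,1,\ldots,2n\}:\sigma_i>\sigma_{i+1}\}$. The second-order Eulerian polynomials are $C_n(x)=\sum_{\sigma\in\mathcal{Q}_n}x^{{\rm des}(\sigma)}$ for $n\geqslant1$, and $C_0(x)=1$. *)

theory Defs
  imports
    "HOL-Library.Multiset"
    "HOL-Computational_Algebra.Polynomial"
    "Jordan_Normal_Form.Determinant"
begin

definition stirling_perms :: "nat \<Rightarrow> nat list set" where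
  "stirling_perms n =
     {\<sigma>. mset \<sigma> = repeat_mset 2 (mset_set {1..n}) \<and>
         (\<forall>p q r. p < q \<and> q < r \<and> r < length \<sigma> \<and> \<sigma> ! p = \<sigma> ! r \<longrightarrow> \<sigma> ! p \<le> \<sigma> ! q)}"

(* The word is padded with a 0 on both sides, so that, in the padded list,
   position i holds the letter \<sigma>_i for 0 \<le> i \<le> length \<sigma> + 1. *)
definition des :: "nat list \<Rightarrow> nat" where
  "des \<sigma> = (let w = 0 # \<sigma> @ [0] in card {i. i \<le> length \<sigma> \<and> w ! i > w ! (i + 1)})"

definition second_eulerian_poly :: "nat \<Rightarrow> int poly" where
  "second_eulerian_poly n =
     (if n = 0 then 1 else (\<Sum>\<sigma>\<in>stirling_perms n. monom 1 (des \<sigma>)))"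

(* Row and column indices i, j start at 1. *)
definition hess_entry :: "nat \<Rightarrow> nat \<Rightarrow> int poly" where
  "hess_entry i j =
     (if j < i then of_nat (i choose (j - 1)) * second_eulerian_poly (i - j)
      else if j = i then of_nat (i choose (i - 1)) * [:0, 1:]
      else if j = i + 1 then -1
      else 0)"

(* The indices of mat start at 0, hence the shift. *)
definition hess_mat :: "nat \<Rightarrow> int poly mat" where
  "hess_mat n = mat n n (\<lambda>(i, j). hess_entry (i + 1) (j + 1))"

lemma finite_stirling_perms: "finite (stirling_perms n)"
proof -
  obtain xs where xs: "mset xs = repeat_mset 2 (mset_set {1..n})"
    using ex_mset by blast
  have "stirling_perms n \<subseteq> {ys. mset ys = mset xs}"
    by (auto simp: stirling_perms_def xs)
  then show ?thesis
    using mset_eq_finite finite_subset by blast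
qed

end

theory Submission
  imports Defs "HOL-Computational_Algebra.Formal_Power_Series"
begin

text \<open>
  Splitting a Stirling permutation at the two copies of its least letter into \<open>A m B m D\<close>, where
  \<open>A\<close>, \<open>B\<close>, \<open>D\<close> are Stirling permutations on disjoint alphabets, shows that the exponential
  generating function \<open>F\<close> of the second-order Eulerian polynomials satisfies
  \<open>F' = F\<^sup>2 (F + x - 1)\<close>. Hence \<open>(1/F)' = -(F + x - 1)\<close>, so that \<open>F = 1 + F E\<close> with
  \<open>E' = F + x - 1\<close> and \<open>E(0) = 0\<close>. Comparing coefficients, the Hessenberg matrix maps the vector
  \<open>(C\<^sub>0, \<dots>, C\<^sub>n\<^sub>-\<^sub>1)\<close> to \<open>(0, \<dots>, 0, C\<^sub>n)\<close>; since \<open>C\<^sub>0 = 1\<close>, replacing its first column by this image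
  leaves the determinant unchanged, and the new determinant is \<open>C\<^sub>n\<close>.
\<close>

section \<open>Splitting a Stirling permutation at its least letter\<close>

text \<open>The condition is phrased through factorizations rather than positions, so that
  concatenating and cutting words become equations between lists.\<close>

definition nested :: "nat list \<Rightarrow> bool" where
  "nested w \<longleftrightarrow> (\<forall>u a v z. w = u @ a # v @ a # z \<longrightarrow> (\<forall>b\<in>set v. a \<le> b))"

lemma nested_iff_nth:
  "nested w \<longleftrightarrow>
     (\<forall>p q r. p < q \<and> q < r \<and> r < length w \<and> w ! p = w ! r \<longrightarrow> w ! p \<le> w ! q)"
proof
  assume n: "nested w"
  show "\<forall>p q r. p < q \<and> q < r \<and> r < length w \<and> w ! p = w ! r \<longrightarrow> w ! p \<le> w ! q"
  proof (intro allI impI, elim conjE)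
    fix p q r assume a: "p < q" "q < r" "r < length w" "w ! p = w ! r"
    define y where "y = drop (Suc p) w"
    have 1: "w = take p w @ w ! p # y"
      unfolding y_def using a by (intro id_take_nth_drop) auto
    have 2: "y = take (r - Suc p) y @ y ! (r - Suc p) # drop (Suc (r - Suc p)) y"
      unfolding y_def using a by (intro id_take_nth_drop) auto
    have 3: "y ! (r - Suc p) = w ! p"
      using a by (simp add: y_def)
    have "w = take p w @ w ! p # take (r - Suc p) y @ w ! p # drop (Suc (r - Suc p)) y"
      using 1 2 3 by metis
    moreover have "w ! q \<in> set (take (r - Suc p) y)"
      unfolding in_set_conv_nth
      by (rule exI[of _ "q - Suc p"]) (use a in \<open>auto simp: y_def\<close>)
    ultimately show "w ! p \<le> w ! q"
      using n unfolding nested_def by blast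
  qed
next
  assume n: "\<forall>p q r. p < q \<and> q < r \<and> r < length w \<and> w ! p = w ! r \<longrightarrow> w ! p \<le> w ! q"
  show "nested w"
    unfolding nested_def
  proof (intro allI impI ballI)
    fix u a v z b assume w: "w = u @ a # v @ a # z" and "b \<in> set v"
    then obtain k where k: "k < length v" "b = v ! k"
      by (metis in_set_conv_nth)
    then show "a \<le> b"
      using n[rule_format, of "length u" "length u + Suc k" "length u + Suc (length v)"]
      by (simp add: w nth_append)
  qed
qed

lemma nested_infix: "nested (u @ v @ z) \<Longrightarrow> nested v"
  unfolding nested_def by (metis append.assoc append_Cons)

text \<open>Since the alphabets are disjoint, two equal letters always lie in the same factor, and
  so does everything between them.\<close>

lemma nested_append:
  assumes "nested A" "nested B" "set A \<inter> set B = {}"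
  shows "nested (A @ B)"
  unfolding nested_def
proof (intro allI impI)
  fix u a v z assume eq: "A @ B = u @ a # v @ a # z"
  show "\<forall>b\<in>set v. a \<le> b"
  proof (cases "a \<in> set A")
    case True
    then have "a \<notin> set B"
      using assms by auto
    have "A @ B = (u @ a # v @ [a]) @ z"
      using eq by simp
    then obtain t where t: "A = (u @ a # v @ [a]) @ t \<and> t @ B = z \<or>
        A @ t = u @ a # v @ [a] \<and> B = t @ z"
      unfolding append_eq_append_conv2 by blast
    \<comment> \<open>If the second \<open>a\<close> lay beyond \<open>A\<close>, it would be the
      last letter of the nonempty word \<open>t\<close>, a prefix of \<open>B\<close>, although
      \<open>a\<close> does not occur in \<open>B\<close>.\<close>
    have False if "t \<noteq> []" "B = t @ z" "A @ t = u @ a # v @ [a]"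
    proof -
      have "last (A @ t) = a"
        by (simp add: that(3))
      then show False
        using that \<open>a \<notin> set B\<close> by (metis UnCI last_appendR last_in_set set_append)
    qed
    then have "A = u @ a # v @ a # t"
      using t by (cases "t = []") auto
    then show ?thesis
      using \<open>nested A\<close> unfolding nested_def by blast
  next
    case False
    obtain t where "A = u @ t \<and> t @ B = a # v @ a # z \<or> A @ t = u \<and> B = t @ a # v @ a # z"
      using eq unfolding append_eq_append_conv2 by blast
    then show ?thesis
    proof
      assume "A = u @ t \<and> t @ B = a # v @ a # z"
      then have "t = []"
        using False by (cases t) auto
      with \<open>A = u @ t \<and> t @ B = a # v @ a # z\<close> have "B = [] @ a # v @ a # z"
        by simp
      then show ?thesis
        using \<open>nested B\<close> unfolding nested_def by blast
    qed (use \<open>nested B\<close> in \<open>auto simp: nested_def\<close>)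
  qed
qed

lemma nested_enclosed:
  assumes "nested B" "\<forall>b\<in>set B. m < b"
  shows "nested (m # B @ [m])"
  unfolding nested_def
proof (intro allI impI)
  fix u a v z assume eq: "m # B @ [m] = u @ a # v @ a # z"
  show "\<forall>b\<in>set v. a \<le> b"
  proof (cases u)
    case Nil
    then have "a = m" "B @ [m] = v @ a # z"
      using eq by auto
    then have "set v \<subseteq> insert m (set B)"
      by (metis Un_insert_right le_supE list.simps(15) set_append sup.cobounded1 sup_bot.right_neutral empty_set)
    then show ?thesis
      using assms(2) \<open>a = m\<close> by (auto intro: less_imp_le)
  next
    case (Cons c u')
    then have eq': "B @ [m] = u' @ a # v @ a # z"
      using eq by auto
    show ?thesis
    proof (cases z rule: rev_cases)
      case Nil
      then have "B @ [m] = (u' @ a # v) @ [a]"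
        using eq' by simp
      then have "B = u' @ a # v" "a = m"
        by simp_all
      then show ?thesis
        using assms(2) by auto
    next
      case (snoc z' c)
      then have "B @ [m] = (u' @ a # v @ a # z') @ [c]"
        using eq' by simp
      then have "B = u' @ a # v @ a # z'"
        by simp
      then show ?thesis
        using \<open>nested B\<close> unfolding nested_def by blast
    qed
  qed
qed

text \<open>An arbitrary alphabet is allowed because the blocks of a split word use arbitrary
  subsets of the letters.\<close>

definition stirling_words :: "nat set \<Rightarrow> nat list set" where
  "stirling_words S = {w. mset w = repeat_mset 2 (mset_set S) \<and> nested w}"

lemma stirling_perms_eq: "stirling_perms n = stirling_words {1..n}"
  by (simp add: stirling_perms_def stirling_words_def nested_iff_nth)

lemma finite_stirling_words: "finite (stirling_words S)"
proof -
  obtain xs where xs: "mset xs = repeat_mset 2 (mset_set S)"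
    using ex_mset by blast
  have "stirling_words S \<subseteq> {ys. mset ys = mset xs}"
    by (auto simp: stirling_words_def xs)
  then show ?thesis
    using mset_eq_finite finite_subset by blast
qed

lemma stirling_words_empty [simp]: "stirling_words {} = {[]}"
  by (auto simp: stirling_words_def nested_def)

lemma stirling_words_iff:
  assumes "finite S"
  shows "w \<in> stirling_words S \<longleftrightarrow>
    nested w \<and> (\<forall>x. count (mset w) x = (if x \<in> S then 2 else 0))"
  using assms by (auto simp: stirling_words_def multiset_eq_iff count_mset_set')

lemma set_stirling_words:
  assumes "finite S" "w \<in> stirling_words S"
  shows "set w = S"
proof -
  have "count (mset w) x = (if x \<in> S then 2 else 0)" for x
    using assms stirling_words_iff by blast
  then show ?thesis
    by (metis count_eq_zero_iff set_mset_mset subsetI subset_antisym zero_neq_numeral)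
qed

lemma join_stirling_words:
  assumes "finite P" "finite Q" "finite R"
    and disj: "P \<inter> Q = {}" "P \<inter> R = {}" "Q \<inter> R = {}"
    and m: "\<forall>x \<in> P \<union> Q \<union> R. m < x"
    and w: "A \<in> stirling_words P" "B \<in> stirling_words Q" "D \<in> stirling_words R"
  shows "A @ m # B @ m # D \<in> stirling_words (insert m (P \<union> Q \<union> R))"
proof -
  have sets: "set A = P" "set B = Q" "set D = R"
    using assms by (auto dest!: set_stirling_words)
  have "nested (m # B @ [m])"
    using assms sets by (intro nested_enclosed) (auto simp: stirling_words_def)
  from nested_append[OF this, of D] have "nested ((m # B @ [m]) @ D)"
    using assms sets by (auto simp: stirling_words_def)
  from nested_append[OF _ this, of A] have "nested (A @ (m # B @ [m]) @ D)"
    using assms sets by (auto simp: stirling_words_def)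
  moreover have "count (mset (A @ m # B @ m # D)) x = (if x \<in> insert m (P \<union> Q \<union> R) then 2 else 0)"
    for x
    using assms by (auto simp: stirling_words_iff)
  ultimately show ?thesis
    using assms by (simp add: stirling_words_iff)
qed

text \<open>The alphabets of the blocks are recovered as their letter sets, which is what
  surjectivity of the later bijection requires.\<close>

lemma split_stirling_words:
  assumes "finite S" "\<forall>x\<in>S. m < x" "w \<in> stirling_words (insert m S)"
  obtains A B D where "w = A @ m # B @ m # D"
    and "set A \<subseteq> S" "set B \<subseteq> S - set A"
    and "A \<in> stirling_words (set A)" "B \<in> stirling_words (set B)"
    and "D \<in> stirling_words (S - set A - set B)"
proof -
  have nest: "nested w" and cnt: "count (mset w) x = (if x \<in> insert m S then 2 else 0)" for x
    using assms stirling_words_iff by blast+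
  have "m \<notin> S"
    using assms by auto
  have "count (mset w) m = 2"
    using cnt by simp
  then have "m \<in> set w"
    by (metis count_eq_zero_iff set_mset_mset zero_neq_numeral)
  then obtain A w' where w': "w = A @ m # w'" "m \<notin> set A"
    by (metis split_list_first)
  then have "count (mset w') m = 1"
    using \<open>count (mset w) m = 2\<close> by (simp add: count_mset count_list_0_iff)
  then have "m \<in> set w'"
    by (metis count_eq_zero_iff set_mset_mset zero_neq_one)
  then obtain B D where BD: "w' = B @ m # D" "m \<notin> set B"
    by (metis split_list_first)
  have w: "w = A @ m # B @ m # D"
    using w' BD by simp
  have "m \<notin> set D"
    using \<open>count (mset w') m = 1\<close> BD by (auto simp: count_mset count_list_0_iff)
  have sum: "count (mset A) x + count (mset B) x + count (mset D) x = (if x \<in> S then 2 else 0)" for x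
  proof (cases "x = m")
    case True
    then show ?thesis
      using \<open>m \<notin> S\<close> \<open>m \<notin> set A\<close> \<open>m \<notin> set B\<close> \<open>m \<notin> set D\<close> by (simp add: count_mset count_list_0_iff)
  next
    case False
    then show ?thesis
      using cnt[of x] by (simp add: w)
  qed
  have sub: "set A \<subseteq> S" "set B \<subseteq> S" "set D \<subseteq> S"
  proof -
    have "x \<in> S" if "x \<in> set A \<union> set B \<union> set D" for x
    proof (rule ccontr)
      assume "x \<notin> S"
      then have "count (mset A) x + count (mset B) x + count (mset D) x = 0"
        using sum[of x] by simp
      then show False
        using that by (auto simp: count_mset count_list_0_iff)
    qed
    then show "set A \<subseteq> S" "set B \<subseteq> S" "set D \<subseteq> S"
      by auto
  qed
  \<comment> \<open>A letter on both sides of an \<open>m\<close> would enclose the smaller letter \<open>m\<close>.\<close>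
  have sep: "set U \<inter> set V = {}" if "w = U @ m # V" "set U \<subseteq> insert m S" for U V
  proof (rule ccontr)
    assume "set U \<inter> set V \<noteq> {}"
    then obtain a where a: "a \<in> set U" "a \<in> set V"
      by blast
    then obtain u v v' z where "U = u @ a # v" "V = v' @ a # z"
      by (metis split_list)
    then have "w = u @ a # (v @ m # v') @ a # z"
      using that by simp
    then have "a \<le> m"
      using nest unfolding nested_def by (metis in_set_conv_decomp)
    then have "a = m"
      using a that(2) assms(2) by fastforce
    \<comment> \<open>The only remaining option \<open>a = m\<close> would give a third copy of
      \<open>m\<close>: one in \<open>U\<close>, one in \<open>V\<close>, and the one between
      them.\<close>
    then have "count (mset w) m \<ge> 3"
      using \<open>w = u @ a # (v @ m # v') @ a # z\<close> by simp
    then show False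
      using \<open>count (mset w) m = 2\<close> by simp
  qed
  have d1: "set A \<inter> set (B @ m # D) = {}"
    using w sub by (intro sep) auto
  have d2: "set (A @ m # B) \<inter> set D = {}"
    using w sub by (intro sep) auto
  have nests: "nested A" "nested B" "nested D"
    using nest nested_infix[of "[]" A "m # B @ m # D"] nested_infix[of "A @ [m]" B "m # D"]
      nested_infix[of "A @ m # B @ [m]" D "[]"] by (simp_all add: w)
  have U: "set A \<union> set B \<union> set D = S"
  proof -
    have "x \<in> set A \<union> set B \<union> set D" if "x \<in> S" for x
    proof (rule ccontr)
      assume "x \<notin> set A \<union> set B \<union> set D"
      then have "count (mset A) x + count (mset B) x + count (mset D) x = 0"
        by (simp add: count_mset count_list_0_iff)
      then show False
        using sum[of x] that by simp
    qed
    then show ?thesis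
      using sub by auto
  qed
  have D: "S - set A - set B = set D"
    using U d1 d2 by auto
  have zero: "count (mset V) x = 0" if "x \<notin> set V" for V and x :: nat
    using that by (simp add: count_mset count_list_0_iff)
  \<comment> \<open>The three multiplicities add up to 2 on \<open>S\<close>, and by disjointness
    only one of them can be nonzero.\<close>
  have counts: "count (mset A) x = (if x \<in> set A then 2 else 0)"
    "count (mset B) x = (if x \<in> set B then 2 else 0)"
    "count (mset D) x = (if x \<in> set D then 2 else 0)" for x
    using sum[of x] zero[of x A] zero[of x B] zero[of x D] sub d1 d2
    by (cases "x \<in> set A"; cases "x \<in> set B"; cases "x \<in> set D"; auto)+
  show ?thesis
  proof
    show "w = A @ m # B @ m # D" by (fact w)
    show "set A \<subseteq> S" "set B \<subseteq> S - set A"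
      using sub d1 by auto
    show "A \<in> stirling_words (set A)" "B \<in> stirling_words (set B)"
      "D \<in> stirling_words (S - set A - set B)"
      using nests counts by (simp_all add: stirling_words_iff D)
  qed
qed

section \<open>Descents of a word cut at its least letter\<close>

fun descents :: "nat list \<Rightarrow> nat" where
  "descents (x # y # zs) = (if x > y then 1 else 0) + descents (y # zs)"
| "descents _ = 0"

lemma descents_conv_card:
  "descents (x # w) = card {i. i < length w \<and> (x # w) ! i > w ! i}"
proof (induction w arbitrary: x)
  case (Cons y w)
  have "{i. i < length (y # w) \<and> (x # y # w) ! i > (y # w) ! i} =
    (if x > y then {0} else {}) \<union> Suc ` {i. i < length w \<and> (y # w) ! i > w ! i}"
    (is "?L = ?R")
  proof (rule Set.set_eqI)
    fix i show "i \<in> ?L \<longleftrightarrow> i \<in> ?R"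
      by (cases i) auto
  qed
  also have "card \<dots> = (if x > y then 1 else 0) +
    card (Suc ` {i. i < length w \<and> (y # w) ! i > w ! i})"
    by (subst card_Un_disjoint) auto
  finally show ?case
    using Cons.IH[of y] by (simp add: card_image)
qed simp

lemma des_conv_descents: "des w = descents (0 # w @ [0])"
  unfolding des_def Let_def descents_conv_card by (intro arg_cong[of _ _ card]) auto

text \<open>The cut letter \<open>m\<close> is kept on both sides, so no adjacent pair is lost or
  counted twice.\<close>

lemma descents_append: "descents (u @ m # v) = descents (u @ [m]) + descents (m # v)"
proof (induction u)
  case (Cons a u)
  then show ?case
    by (cases u) auto
qed simp

text \<open>Entering \<open>A\<close> from a smaller letter is an ascent and leaving it to a smaller
  letter is a descent. The padding zeros of \<open>des\<close> behave in the same way, so they may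
  be exchanged for \<open>l\<close> and \<open>r\<close>.\<close>

lemma descents_enclosed:
  assumes "A \<noteq> []" "\<forall>a\<in>set A. l < a \<and> r < a"
  shows "descents (l # A @ [r]) = des A"
proof -
  have last: "descents (B @ [b, r]) = descents (B @ [b, 0])" if "r < b" for B b
    using descents_append[of B b "[r]"] descents_append[of B b "[0]"] that by simp
  obtain a A' where A: "A = a # A'"
    using assms by (cases A) auto
  obtain B b where B: "A = B @ [b]"
    using assms by (cases A rule: rev_cases) auto
  have "descents (l # A @ [r]) = descents (A @ [r])"
    using assms by (simp add: A)
  also have "\<dots> = descents (A @ [0])"
    using last[of b B] assms by (simp add: B)
  also have "\<dots> = des A"
    using assms by (simp add: des_conv_descents A)
  finally show ?thesis .
qed

text \<open>Each block is bordered by smaller letters, so its descents are those of the block alone.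
  Empty \<open>A\<close> or \<open>B\<close> gives the pair \<open>0 m\<close> or
  \<open>m m\<close>, which is no descent; empty \<open>D\<close> gives the pair \<open>m 0\<close>,
  which is one.\<close>

lemma des_join:
  assumes "0 < m" "\<forall>a\<in>set A \<union> set B \<union> set D. m < a"
  shows "des (A @ m # B @ m # D) = des A + des B + (if D = [] then 1 else des D)"
proof -
  have pos: "\<forall>a\<in>set A. 0 < a \<and> m < a"
    using assms by auto
  have "des (A @ m # B @ m # D) = descents (0 # A @ [m]) + descents (m # B @ m # D @ [0])"
    unfolding des_conv_descents using descents_append[of "0 # A" m "B @ m # D @ [0]"] by simp
  also have "descents (m # B @ m # D @ [0]) = descents (m # B @ [m]) + descents (m # D @ [0])"
    using descents_append[of "m # B" m "D @ [0]"] by simp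
  also have "descents (0 # A @ [m]) = des A"
    using pos by (cases "A = []") (auto simp: descents_enclosed des_conv_descents[of "[]"])
  also have "descents (m # B @ [m]) = des B"
    using assms by (cases "B = []") (auto simp: descents_enclosed des_conv_descents[of "[]"])
  also have "descents (m # D @ [0]) = (if D = [] then 1 else des D)"
    using assms by (auto intro!: descents_enclosed)
  finally show ?thesis
    by simp
qed

section \<open>The convolution recurrence\<close>

definition stirling_poly :: "nat set \<Rightarrow> int poly" where
  "stirling_poly S = (\<Sum>w\<in>stirling_words S. monom 1 (des w))"

text \<open>The empty block has weight x because the second copy of the least letter is then
  followed by the padding zero.\<close>

definition last_block_poly :: "nat set \<Rightarrow> int poly" where
  "last_block_poly S = (if S = {} then [:0, 1:] else stirling_poly S)"

lemma stirling_poly_empty [simp]: "stirling_poly {} = 1"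
  by (simp add: stirling_poly_def des_conv_descents monom_0 one_pCons)

lemma second_eulerian_poly_eq: "second_eulerian_poly n = stirling_poly {1..n}"
  by (cases "n = 0") (simp_all add: second_eulerian_poly_def stirling_perms_eq flip: stirling_poly_def)

lemma split_list_first_unique:
  "u @ m # v = u' @ m # v' \<Longrightarrow> m \<notin> set u \<Longrightarrow> m \<notin> set u' \<Longrightarrow> u = u' \<and> v = v'"
proof (induction u arbitrary: u')
  case Nil
  then show ?case
    by (cases u') auto
next
  case (Cons a u)
  then show ?case
    by (cases u') auto
qed

text \<open>Cutting at the two copies of \<open>m\<close> is a bijection onto triples of blocks
  together with their alphabets, and by \<open>des_join\<close> the weight is multiplicative under
  it.\<close>

lemma stirling_poly_insert:
  assumes S: "finite S" and m: "0 < m" "\<forall>x\<in>S. m < x"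
  shows "stirling_poly (insert m S) =
    (\<Sum>P\<in>Pow S. stirling_poly P *
      (\<Sum>Q\<in>Pow (S - P). stirling_poly Q * last_block_poly (S - P - Q)))"
proof -
  define I where "I = (SIGMA P:Pow S. SIGMA Q:Pow (S - P).
    stirling_words P \<times> stirling_words Q \<times> stirling_words (S - P - Q))"
  define g where "g = (\<lambda>(P :: nat set, Q :: nat set, A, B, D). A @ m # B @ m # D)"
  define wt :: "nat list \<Rightarrow> int poly"
    where "wt D = (if D = [] then [:0, 1:] else monom 1 (des D))" for D
  have wt: "sum wt (stirling_words R) = last_block_poly R" if "finite R" for R
  proof (cases "R = {}")
    case False
    then have "D \<noteq> []" if "D \<in> stirling_words R" for D
      using set_stirling_words[OF \<open>finite R\<close> that] by auto
    then show ?thesis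
      using False by (auto simp: last_block_poly_def wt_def stirling_poly_def intro!: sum.cong)
  qed (simp add: last_block_poly_def wt_def)
  have I: "P \<subseteq> S \<and> Q \<subseteq> S - P \<and> A \<in> stirling_words P \<and> B \<in> stirling_words Q \<and>
      D \<in> stirling_words (S - P - Q) \<and> set A = P \<and> set B = Q \<and> set D = S - P - Q"
    if "(P, Q, A, B, D) \<in> I" for P Q A B D
  proof -
    have 1: "P \<subseteq> S" "Q \<subseteq> S - P" "A \<in> stirling_words P" "B \<in> stirling_words Q"
      "D \<in> stirling_words (S - P - Q)"
      using that by (auto simp: I_def)
    moreover have "finite P" "finite Q" "finite (S - P - Q)"
      using 1 S by (auto intro: finite_subset)
    ultimately show ?thesis
      using set_stirling_words by blast
  qed
  have "bij_betw g I (stirling_words (insert m S))"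
    unfolding bij_betw_def
  proof
    have "m \<notin> S"
      using m by auto
    show "inj_on g I"
    proof (rule inj_onI)
      fix s t assume st: "s \<in> I" "t \<in> I" "g s = g t"
      obtain P Q A B D where s: "s = (P, Q, A, B, D)" by (cases s)
      obtain P' Q' A' B' D' where t: "t = (P', Q', A', B', D')" by (cases t)
      note Is = I[OF st(1)[unfolded s]] and It = I[OF st(2)[unfolded t]]
      have eq: "A @ m # B @ m # D = A' @ m # B' @ m # D'"
        using st by (simp add: g_def s t)
      \<comment> \<open>No block contains \<open>m\<close>, so the first \<open>m\<close> determines
        \<open>A\<close>; the same argument applied to the rest determines \<open>B\<close> and
        \<open>D\<close>.\<close>
      have 1: "A = A' \<and> B @ m # D = B' @ m # D'"
        using Is It \<open>m \<notin> S\<close> by (intro split_list_first_unique[OF eq]) auto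
      then have "B = B' \<and> D = D'"
        using Is It \<open>m \<notin> S\<close> by (intro split_list_first_unique) auto
      then show "s = t"
        using 1 Is It by (auto simp: s t)
    qed
    show "g ` I = stirling_words (insert m S)"
    proof
      show "g ` I \<subseteq> stirling_words (insert m S)"
      proof
        fix w assume "w \<in> g ` I"
        then obtain P Q A B D where i: "(P, Q, A, B, D) \<in> I" and w: "w = A @ m # B @ m # D"
          by (auto simp: g_def)
        note i = I[OF i]
        have "P \<union> Q \<union> (S - P - Q) = S"
          using i by auto
        moreover have "w \<in> stirling_words (insert m (P \<union> Q \<union> (S - P - Q)))"
          unfolding w using i S m
          by (intro join_stirling_words) (auto intro: finite_subset)
        ultimately show "w \<in> stirling_words (insert m S)"
          by simp
      qed
      show "stirling_words (insert m S) \<subseteq> g ` I"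
      proof
        fix w assume "w \<in> stirling_words (insert m S)"
        from split_stirling_words[OF S m(2) this] obtain A B D where "w = A @ m # B @ m # D"
          "set A \<subseteq> S" "set B \<subseteq> S - set A"
          "A \<in> stirling_words (set A)" "B \<in> stirling_words (set B)"
          "D \<in> stirling_words (S - set A - set B)" by metis
        then have "(set A, set B, A, B, D) \<in> I" "w = g (set A, set B, A, B, D)"
          by (simp_all add: I_def g_def)
        then show "w \<in> g ` I"
          by blast
      qed
    qed
  qed
  then have "stirling_poly (insert m S) = (\<Sum>s\<in>I. monom 1 (des (g s)))"
    unfolding stirling_poly_def by (rule sum.reindex_bij_betw[symmetric])
  also have "\<dots> = (\<Sum>(P, Q, A, B, D)\<in>I. monom 1 (des A) * (monom 1 (des B) * wt D))"
  proof (rule sum.cong)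
    fix s assume "s \<in> I"
    obtain P Q A B D where s: "s = (P, Q, A, B, D)" by (cases s)
    have "des (A @ m # B @ m # D) = des A + des B + (if D = [] then 1 else des D)"
      using I[OF \<open>s \<in> I\<close>[unfolded s]] m by (intro des_join) auto
    moreover have "[:0, 1:] = monom (1 :: int) 1"
      by (simp add: monom_altdef)
    ultimately show "monom 1 (des (g s)) =
      (case s of (P, Q, A, B, D) \<Rightarrow> monom 1 (des A) * (monom 1 (des B) * wt D))"
      by (simp add: s g_def wt_def mult_monom add.assoc)
  qed simp
  also have "\<dots> = (\<Sum>P\<in>Pow S. \<Sum>Q\<in>Pow (S - P).
      \<Sum>A\<in>stirling_words P. \<Sum>B\<in>stirling_words Q. \<Sum>D\<in>stirling_words (S - P - Q).
        monom 1 (des A) * (monom 1 (des B) * wt D))"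
    unfolding I_def using S
    by (simp add: sum.Sigma[symmetric] sum.cartesian_product[symmetric] finite_stirling_words
        finite_SigmaI)
  also have "\<dots> = (\<Sum>P\<in>Pow S. stirling_poly P *
      (\<Sum>Q\<in>Pow (S - P). stirling_poly Q * sum wt (stirling_words (S - P - Q))))"
    unfolding stirling_poly_def by (simp flip: sum_distrib_left sum_distrib_right)
  also have "\<dots> = (\<Sum>P\<in>Pow S. stirling_poly P *
      (\<Sum>Q\<in>Pow (S - P). stirling_poly Q * last_block_poly (S - P - Q)))"
    using S by (simp add: wt)
  finally show ?thesis .
qed

section \<open>Dependence on the size of the alphabet only\<close>

lemma sum_Pow_card:
  fixes f :: "nat \<Rightarrow> 'a :: comm_semiring_1"
  assumes "finite S"
  shows "(\<Sum>P\<in>Pow S. f (card P)) = (\<Sum>k\<le>card S. of_nat (card S choose k) * f k)"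
proof -
  have "(\<Sum>P\<in>Pow S. f (card P)) = (\<Sum>k\<le>card S. \<Sum>P\<in>{P \<in> Pow S. card P = k}. f (card P))"
    using assms by (intro sum.group[symmetric]) (auto intro: card_mono)
  also have "\<dots> = (\<Sum>k\<le>card S. \<Sum>P\<in>{P. P \<subseteq> S \<and> card P = k}. f k)"
    by (intro sum.cong) auto
  also have "\<dots> = (\<Sum>k\<le>card S. of_nat (card S choose k) * f k)"
    using assms by (simp add: n_subsets)
  finally show ?thesis .
qed

text \<open>These are the coefficients of the exponential generating function
  \<open>F + x - 1\<close>.\<close>

definition last_block_coeff :: "nat \<Rightarrow> int poly" where
  "last_block_coeff k = (if k = 0 then [:0, 1:] else second_eulerian_poly k)"

lemma stirling_poly_insert_card:
  assumes S: "finite S" and m: "0 < m" "\<forall>x\<in>S. m < x"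
    and IH: "\<And>T. T \<subseteq> S \<Longrightarrow> stirling_poly T = second_eulerian_poly (card T)"
  shows "stirling_poly (insert m S) =
    (\<Sum>k\<le>card S. of_nat (card S choose k) * (second_eulerian_poly k *
      (\<Sum>l\<le>card S - k. of_nat ((card S - k) choose l) *
        (second_eulerian_poly l * last_block_coeff (card S - k - l)))))"
proof -
  have last: "last_block_poly T = last_block_coeff (card T)" if "T \<subseteq> S" for T
    using that S IH[OF that] finite_subset[of T S]
    by (auto simp: last_block_poly_def last_block_coeff_def)
  have inner: "(\<Sum>Q\<in>Pow (S - P). stirling_poly Q * last_block_poly (S - P - Q)) =
    (\<Sum>l\<le>card S - card P. of_nat ((card S - card P) choose l) *
        (second_eulerian_poly l * last_block_coeff (card S - card P - l)))" (is "?L = ?R")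
    if "P \<subseteq> S" for P
  proof -
    have P: "finite P" "card (S - P) = card S - card P"
      using that S by (auto intro: finite_subset intro!: card_Diff_subset)
    have "?L = (\<Sum>Q\<in>Pow (S - P).
        second_eulerian_poly (card Q) * last_block_coeff (card S - card P - card Q))"
    proof (rule sum.cong)
      fix Q assume "Q \<in> Pow (S - P)"
      then have Q: "Q \<subseteq> S - P" "finite Q" "Q \<subseteq> S" "S - P - Q \<subseteq> S"
        using S by (auto intro: finite_subset)
      then show "stirling_poly Q * last_block_poly (S - P - Q) =
        second_eulerian_poly (card Q) * last_block_coeff (card S - card P - card Q)"
        using P by (simp add: IH last card_Diff_subset)
    qed simp
    also have "\<dots> = ?R"
      using S sum_Pow_card[of "S - P"
        "\<lambda>k. second_eulerian_poly k * last_block_coeff (card S - card P - k)"] P by simp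
    finally show ?thesis .
  qed
  have "stirling_poly (insert m S) = (\<Sum>P\<in>Pow S. second_eulerian_poly (card P) *
    (\<Sum>l\<le>card S - card P. of_nat ((card S - card P) choose l) *
        (second_eulerian_poly l * last_block_coeff (card S - card P - l))))"
    unfolding stirling_poly_insert[OF S m] using inner IH by (intro sum.cong) auto
  also have "\<dots> = (\<Sum>k\<le>card S. of_nat (card S choose k) * (second_eulerian_poly k *
      (\<Sum>l\<le>card S - k. of_nat ((card S - k) choose l) *
        (second_eulerian_poly l * last_block_coeff (card S - k - l)))))"
    using sum_Pow_card[OF S, of "\<lambda>k. second_eulerian_poly k *
      (\<Sum>l\<le>card S - k. of_nat ((card S - k) choose l) *
        (second_eulerian_poly l * last_block_coeff (card S - k - l)))"] .
  finally show ?thesis .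
qed

text \<open>Instead of an order-preserving relabelling, strong induction is used: splitting off the
  minimum expresses the polynomial through smaller cardinalities alone. The letter 0 is excluded
  because it would tie with the padding.\<close>

lemma stirling_poly_card:
  "finite S \<Longrightarrow> 0 \<notin> S \<Longrightarrow> stirling_poly S = second_eulerian_poly (card S)"
proof (induction "card S" arbitrary: S rule: less_induct)
  case less
  show ?case
  proof (cases "S = {}")
    case False
    define n where "n = card S"
    have "n > 0"
      using False less.prems by (simp add: n_def card_gt_0_iff)
    have IH: "stirling_poly T = second_eulerian_poly (card T)"
      if "finite T" "0 \<notin> T" "card T < n" for T
      using that less.hyps[of T] by (simp add: n_def)
    define f where "f k = (\<Sum>i\<le>k. of_nat (k choose i) * (second_eulerian_poly i *
      (\<Sum>l\<le>k - i. of_nat ((k - i) choose l) *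
        (second_eulerian_poly l * last_block_coeff (k - i - l)))))" for k
    have main: "stirling_poly T = f (n - 1)" if T: "finite T" "0 \<notin> T" "card T = n" for T
    proof -
      have "T \<noteq> {}"
        using T \<open>n > 0\<close> by auto
      define m where "m = Min T"
      have m: "m \<in> T" "\<forall>x\<in>T - {m}. m < x"
        using T \<open>T \<noteq> {}\<close> by (auto simp: m_def order_less_le)
      have card: "card (T - {m}) = n - 1"
        using m T by simp
      have "card U < n" if "U \<subseteq> T - {m}" for U
        using card card_mono[OF _ that] T \<open>n > 0\<close> by simp
      then have "stirling_poly (insert m (T - {m})) = f (card (T - {m}))"
        unfolding f_def using m T
        by (intro stirling_poly_insert_card IH)
          (auto intro: finite_subset intro!: gr0I)
      then show ?thesis
        using m card by (simp add: insert_absorb)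
    qed
    \<comment> \<open>Both alphabets have \<open>n\<close> letters, so both polynomials equal
      \<open>f (n - 1)\<close>.\<close>
    have "stirling_poly S = stirling_poly {1..n}"
      using main[of S] main[of "{1..n}"] less.prems by (simp add: n_def)
    then show ?thesis
      by (simp add: second_eulerian_poly_eq n_def)
  qed (simp add: second_eulerian_poly_def)
qed

lemma second_eulerian_poly_Suc:
  "second_eulerian_poly (Suc n) =
    (\<Sum>k\<le>n. of_nat (n choose k) * (second_eulerian_poly k *
      (\<Sum>l\<le>n - k. of_nat ((n - k) choose l) *
        (second_eulerian_poly l * last_block_coeff (n - k - l)))))"
proof -
  have "second_eulerian_poly (Suc n) = stirling_poly (insert 1 {2..Suc n})"
    unfolding second_eulerian_poly_eq
    by (rule arg_cong[of _ _ stirling_poly]) auto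
  also have "\<dots> = (\<Sum>k\<le>n. of_nat (n choose k) * (second_eulerian_poly k *
      (\<Sum>l\<le>n - k. of_nat ((n - k) choose l) *
        (second_eulerian_poly l * last_block_coeff (n - k - l)))))"
    by (subst stirling_poly_insert_card)
      (auto intro!: stirling_poly_card intro: finite_subset)
  finally show ?thesis .
qed

section \<open>Exponential generating functions\<close>

definition egf :: "(nat \<Rightarrow> 'a :: field_char_0) \<Rightarrow> 'a fps" where
  "egf a = Abs_fps (\<lambda>n. a n / fact n)"

lemma egf_nth [simp]: "fps_nth (egf a) n = a n / fact n"
  by (simp add: egf_def)

lemma egf_mult: "egf a * egf b = egf (\<lambda>n. \<Sum>k\<le>n. of_nat (n choose k) * (a k * b (n - k)))"
proof (rule fps_ext)
  fix n
  have "a k / fact k * (b (n - k) / fact (n - k)) =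
      of_nat (n choose k) * (a k * b (n - k)) / fact n" if "k \<le> n" for k
    using that by (simp add: binomial_fact)
  then show "fps_nth (egf a * egf b) n =
    fps_nth (egf (\<lambda>n. \<Sum>k\<le>n. of_nat (n choose k) * (a k * b (n - k)))) n"
    unfolding fps_mult_nth egf_nth sum_divide_distrib atLeast0AtMost by (intro sum.cong) auto
qed

lemma egf_deriv: "fps_deriv (egf a) = egf (\<lambda>n. a (Suc n))"
  by (rule fps_ext) (simp add: divide_simps del: of_nat_Suc)

text \<open>The double convolution says \<open>F' = F * F * G\<close> for the generating functions
  of \<open>a\<close> and \<open>b\<close>. Passing to \<open>1/F\<close> makes the equation linear
  and leaves a single convolution. Values in a field make the factorials invertible.\<close>

lemma binomial_convolution_linearize:
  fixes a b :: "nat \<Rightarrow> 'a :: field_char_0"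
  assumes a0: "a 0 = 1" and b: "\<And>k. k > 0 \<Longrightarrow> b k = a k"
    and rec: "\<And>n. a (Suc n) = (\<Sum>k\<le>n. of_nat (n choose k) * (a k *
      (\<Sum>l\<le>n - k. of_nat ((n - k) choose l) * (a l * b (n - k - l)))))"
    and "n > 0"
  shows "a n = (\<Sum>k<n. of_nat (n choose k) * (a k * b (n - 1 - k)))"
proof -
  \<comment> \<open>Shifting \<open>b\<close> by one index integrates its exponential generating
    function, with constant term 0.\<close>
  define e where "e k = (if k = 0 then 0 else b (k - 1))" for k
  have "fps_deriv (egf a) = egf a * (egf a * egf b)"
    unfolding egf_mult egf_deriv using rec by simp
  then have "fps_deriv (inverse (egf a)) = - (inverse (egf a) * egf a)\<^sup>2 * egf b"
    using a0 by (simp add: fps_inverse_deriv power2_eq_square mult_ac)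
  also have "\<dots> = - egf b"
    using a0 by (simp add: inverse_mult_eq_1)
  also have "\<dots> = fps_deriv (1 - egf e)"
    by (simp add: egf_deriv e_def)
  finally have "inverse (egf a) =
      fps_const (fps_nth (inverse (egf a)) 0 - fps_nth (1 - egf e) 0) + (1 - egf e)"
    by (rule fps_deriv_eq_iff[THEN iffD1])
  \<comment> \<open>The constant of integration vanishes, since both series have constant term
    1.\<close>
  then have "inverse (egf a) = 1 - egf e"
    using a0 by (simp add: e_def)
  then have "egf a * (1 - egf e) = 1"
    using a0 by (metis div_by_1 egf_nth fact_0 inverse_mult_eq_1' zero_neq_one)
  then have "egf a = 1 + egf a * egf e"
    by (simp add: algebra_simps)
  then have "fps_nth (egf a) n = fps_nth (1 + egf a * egf e) n"
    by simp
  then have "a n = (\<Sum>k\<le>n. of_nat (n choose k) * (a k * e (n - k)))"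
    using \<open>n > 0\<close> unfolding egf_mult by simp
  \<comment> \<open>The term \<open>k = n\<close> drops out because \<open>e 0 = 0\<close>.\<close>
  also have "\<dots> = (\<Sum>k<n. of_nat (n choose k) * (a k * b (n - 1 - k)))"
    by (simp add: e_def flip: lessThan_Suc_atMost)
  finally show ?thesis .
qed

text \<open>Integer polynomials do not form a field, so the identity is proved in the rationals
  after evaluation at each integer \<open>q\<close>; integer polynomials that agree at all integers
  are equal.\<close>

lemma second_eulerian_poly_rec:
  assumes "n > 0"
  shows "second_eulerian_poly n =
    (\<Sum>k<n. of_nat (n choose k) * (second_eulerian_poly k * last_block_coeff (n - 1 - k)))"
proof -
  have "poly (second_eulerian_poly n) q = poly
    (\<Sum>k<n. of_nat (n choose k) * (second_eulerian_poly k * last_block_coeff (n - 1 - k))) q" for q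
  proof -
    define a :: "nat \<Rightarrow> rat" where "a k = of_int (poly (second_eulerian_poly k) q)" for k
    define b :: "nat \<Rightarrow> rat" where "b k = of_int (poly (last_block_coeff k) q)" for k
    have "a n = (\<Sum>k<n. of_nat (n choose k) * (a k * b (n - 1 - k)))"
    proof (rule binomial_convolution_linearize)
      show "a (Suc n) = (\<Sum>k\<le>n. of_nat (n choose k) * (a k *
        (\<Sum>l\<le>n - k. of_nat ((n - k) choose l) * (a l * b (n - k - l)))))" for n
        unfolding a_def b_def second_eulerian_poly_Suc[of n] by (simp add: poly_sum)
    qed (use assms in \<open>simp_all add: a_def b_def last_block_coeff_def second_eulerian_poly_def\<close>)
    also have "\<dots> = of_int (poly
      (\<Sum>k<n. of_nat (n choose k) * (second_eulerian_poly k * last_block_coeff (n - 1 - k))) q)"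
      by (simp add: a_def b_def poly_sum)
    finally show ?thesis
      unfolding a_def of_int_eq_iff .
  qed
  then show ?thesis
    by (simp add: poly_eq_poly_eq_iff[symmetric] fun_eq_iff)
qed

section \<open>The Hessenberg determinant\<close>

text \<open>As \<open>last_block_coeff 0\<close> is x, one formula covers the diagonal and
  everything below it, which matches the summands of the single convolution.\<close>

lemma hess_entry_le:
  assumes "j \<le> i"
  shows "hess_entry (i + 1) (j + 1) = of_nat ((i + 1) choose j) * last_block_coeff (i - j)"
  using assms by (auto simp: hess_entry_def last_block_coeff_def)

lemma hess_entry_gt:
  assumes "i < j"
  shows "hess_entry (i + 1) (j + 1) = (if j = i + 1 then -1 else 0)"
  using assms by (simp add: hess_entry_def)

text \<open>The entries up to the diagonal sum to \<open>second_eulerian_poly (i + 1)\<close> by the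
  recurrence. The entry -1 to the right of the diagonal cancels this, except in the last row, where
  that column is missing.\<close>

lemma hess_row_sum:
  assumes "i < n"
  shows "(\<Sum>j<n. hess_entry (i + 1) (j + 1) * second_eulerian_poly j) =
    (if i = n - 1 then second_eulerian_poly n else 0)"
proof -
  have low: "(\<Sum>j<i + 1. hess_entry (i + 1) (j + 1) * second_eulerian_poly j) =
    second_eulerian_poly (i + 1)"
    by (subst second_eulerian_poly_rec[of "i + 1"], simp)
      (intro sum.cong, auto simp: hess_entry_le[simplified] mult_ac)
  show ?thesis
  proof (cases "i = n - 1")
    case True
    then show ?thesis
      using low assms by simp
  next
    case False
    have "(\<Sum>j<n. hess_entry (i + 1) (j + 1) * second_eulerian_poly j) =
      (\<Sum>j<i + 2. hess_entry (i + 1) (j + 1) * second_eulerian_poly j)"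
      using assms False by (intro sum.mono_neutral_right) (auto simp: hess_entry_def)
    also have "\<dots> = 0"
      using low by (simp add: hess_entry_gt[simplified])
    finally show ?thesis
      using False by simp
  qed
qed

theorem theorem2p4:
  fixes n :: nat
  assumes "n \<ge> 1"
  shows "second_eulerian_poly n = det (hess_mat n)"
proof -
  \<comment> \<open>The identity matrix with its first column replaced by the vector of polynomials;
    multiplying by it on the right alters only the first column of
    \<open>hess_mat n\<close>.\<close>
  define M where "M = mat n n (\<lambda>(i, j).
    if j = 0 then second_eulerian_poly i else if i = j then 1 else 0)"
  define K where "K = mat n n (\<lambda>(i, j). if j = 0
    then (if i = n - 1 then second_eulerian_poly n else 0) else hess_entry (i + 1) (j + 1))"
  have dims: "hess_mat n \<in> carrier_mat n n" "M \<in> carrier_mat n n" "K \<in> carrier_mat n n"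
    by (simp_all add: hess_mat_def M_def K_def)
  have "hess_mat n * M = K"
  proof (rule eq_matI)
    fix i j assume "i < dim_row K" "j < dim_col K"
    then have ij: "i < n" "j < n"
      by (simp_all add: K_def)
    have "(hess_mat n * M) $$ (i, j) = (\<Sum>k<n. hess_entry (i + 1) (k + 1) *
      (if j = 0 then second_eulerian_poly k else if k = j then 1 else 0))"
      using ij by (simp add: hess_mat_def M_def scalar_prod_def atLeast0LessThan)
    also have "\<dots> = K $$ (i, j)"
    proof (cases "j = 0")
      case True
      then show ?thesis
        using ij hess_row_sum[of i n] by (simp add: K_def)
    next
      case False
      then show ?thesis
        using ij by (simp add: K_def if_distrib[of "(*) _"] sum.delta cong: if_cong)
    qed
    finally show "(hess_mat n * M) $$ (i, j) = K $$ (i, j)" .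
  qed (simp_all add: hess_mat_def M_def K_def)
  \<comment> \<open>\<open>M\<close> is lower triangular, and its corner entry is
    \<open>second_eulerian_poly 0 = 1\<close>.\<close>
  moreover have "det M = 1"
  proof -
    have "det M = prod_list (diag_mat M)"
      by (rule det_lower_triangular[OF _ dims(2)]) (auto simp: M_def)
    also have "diag_mat M = replicate n 1"
      by (intro nth_equalityI) (auto simp: diag_mat_def M_def second_eulerian_poly_def)
    finally show ?thesis
      by simp
  qed
  ultimately have "det (hess_mat n) = det K"
    using det_mult[OF dims(1,2)] by simp
  also have "\<dots> = (\<Sum>i<n. K $$ (i, 0) * cofactor K i 0)"
    using assms by (intro laplace_expansion_column[OF dims(3)]) simp
  \<comment> \<open>The first column of \<open>K\<close> vanishes outside its last row.\<close>
  also have "\<dots> = (\<Sum>i\<in>{n - 1}. K $$ (i, 0) * cofactor K i 0)"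
    using assms by (intro sum.mono_neutral_right) (auto simp: K_def)
  also have "\<dots> = second_eulerian_poly n * cofactor K (n - 1) 0"
    using assms by (simp add: K_def)
  also have "cofactor K (n - 1) 0 = 1"
  proof -
    define L where "L = mat_delete K (n - 1) 0"
    \<comment> \<open>Deleting the first column moves the superdiagonal onto the diagonal, so
      \<open>L\<close> is lower triangular with diagonal entries -1; its determinant cancels the
      sign of the cofactor.\<close>
    have L: "L = mat (n - 1) (n - 1) (\<lambda>(i, j). hess_entry (i + 1) (j + 2))"
      by (rule eq_matI) (auto simp: L_def K_def mat_delete_def)
    have "det L = prod_list (diag_mat L)"
      by (rule det_lower_triangular[of "n - 1"]) (auto simp: L hess_entry_def)
    also have "diag_mat L = replicate (n - 1) (-1)"
      by (intro nth_equalityI) (auto simp: diag_mat_def L hess_entry_def)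
    finally have "det (mat_delete K (n - 1) 0) = (-1) ^ (n - 1)"
      by (simp add: L_def)
    then show ?thesis
      by (simp add: cofactor_def flip: power_mult_distrib)
  qed
  finally show ?thesis
    by simp
qed

end
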